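(* For every $\lambda\in\mathbb R^m$ and all $u,v\in\mathbb R^m$, $$\bigl|\nabla^3\phi_{\rm se}(\lambda)[u,u,v]\bigr|\le\frac{\max_j|a_j^\top v|}{\gamma}\,\nabla^2\phi_{\rm se}(\lambda)[u,u]\le\frac{\rho\|v\|_2}{\gamma}\,\nabla^2\phi_{\rm se}(\lambda)[u,u],$$ so $\phi_{\rm se}$ is quasi-self-concordant with parameter $M_{\rm qsc}(\phi_{\rm se})\le\rho/\gamma$ (no worse than the column-norm bound $2\rho/\gamma$ for the log-sum-exp dual).
   Context: Let $A\in\mathbb R^{m\times n}$ with columns $a_1,\dots,a_n$, $b\in\mathbb R^m$, $c\in\mathbb R^n$, $\gamma>0$, $\rho=\max_j\|a_j\|_2$; standing assumption of the paper: there is $q\in\mathbb R^m$ with $A^\top q=\mathbf 1$, $\langle q,b\rangle=1$, and there is $\bar x>0$ (entrywise) with $A\bar x=b$. The sum-exp dual is $\phi_{\rm se}(\lambda)=-\langle b,\lambda\rangle+\gamma\sum_{j=1}^n\exp((a_j^\top\lambda-c_j)/\gamma)$; the log-sum-exp dual is $-\langle b,\lambda\rangle+\gamma\log\sum_{j=1}^n\exp((a_j^\top\lambda-c_j)/\gamma)$. A convex $C^3$ function $f$ is quasi-self-concordant with parameter $M_{\rm qsc}$ if $|\nabla^3f(\lambda)[u,u,v]|\le M_{\rm qsc}\,\nabla^2f(\lambda)[u,u]\,\|v\|_2$ for all $\lambda,u,v$. *)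

theory Defs
  imports "HOL-Analysis.Analysis"
begin

text \<open>
  The Frechet derivative is packaged as a bounded linear function, so that it takes values in a
  normed space and can be differentiated again. It is meaningful only where \<open>f\<close> is differentiable.
\<close>

definition fderiv ::
    "('a::real_normed_vector \<Rightarrow> 'b::real_normed_vector) \<Rightarrow> 'a \<Rightarrow> ('a \<Rightarrow>\<^sub>L 'b)" where
  "fderiv f x = Blinfun (frechet_derivative f (at x))"

definition nabla2 :: "('a::real_normed_vector \<Rightarrow> real) \<Rightarrow> 'a \<Rightarrow> 'a \<Rightarrow> 'a \<Rightarrow> real" where
  "nabla2 f x u v = blinfun_apply (blinfun_apply (fderiv (fderiv f) x) u) v"

text \<open>
  The first argument is the direction of the last differentiation; for \<open>C\<^sup>3\<close> functions the form is
  symmetric, so the order is immaterial.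
\<close>

definition nabla3 :: "('a::real_normed_vector \<Rightarrow> real) \<Rightarrow> 'a \<Rightarrow> 'a \<Rightarrow> 'a \<Rightarrow> 'a \<Rightarrow> real" where
  "nabla3 f x u v w =
     blinfun_apply (blinfun_apply (blinfun_apply (fderiv (fderiv (fderiv f)) x) u) v) w"

definition C3 :: "('a::real_normed_vector \<Rightarrow> real) \<Rightarrow> bool" where
  "C3 f \<longleftrightarrow>
     (\<forall>x. f differentiable (at x)) \<and>
     (\<forall>x. fderiv f differentiable (at x)) \<and>
     (\<forall>x. fderiv (fderiv f) differentiable (at x)) \<and>
     continuous_on UNIV (fderiv (fderiv (fderiv f)))"

definition quasi_self_concordant :: "('a::euclidean_space \<Rightarrow> real) \<Rightarrow> real \<Rightarrow> bool" where
  "quasi_self_concordant f M \<longleftrightarrow>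
     convex_on UNIV f \<and> C3 f \<and>
     (\<forall>x u v. \<bar>nabla3 f x u u v\<bar> \<le> M * nabla2 f x u u * norm v)"

text \<open>
  The best parameter of \<open>f\<close>. It is meaningful only if some parameter exists, since \<open>Inf\<close> of the
  empty set of reals is unspecified. The sign condition makes the set bounded below also when the
  Hessian of \<open>f\<close> vanishes identically.
\<close>

definition M_qsc :: "('a::euclidean_space \<Rightarrow> real) \<Rightarrow> real" where
  "M_qsc f = Inf {M. 0 \<le> M \<and> quasi_self_concordant f M}"

definition max_col_norm :: "real^'n^'m \<Rightarrow> real" where
  "max_col_norm A = Max (range (\<lambda>j. norm (column j A)))"

definition sum_exp_dual ::
    "real^'n^'m \<Rightarrow> real^'m \<Rightarrow> real^'n \<Rightarrow> real \<Rightarrow> real^'m \<Rightarrow> real" where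
  "sum_exp_dual A b c \<gamma> l =
     - (b \<bullet> l) + \<gamma> * (\<Sum>j\<in>UNIV. exp ((column j A \<bullet> l - c $ j) / \<gamma>))"

definition log_sum_exp_dual ::
    "real^'n^'m \<Rightarrow> real^'m \<Rightarrow> real^'n \<Rightarrow> real \<Rightarrow> real^'m \<Rightarrow> real" where
  "log_sum_exp_dual A b c \<gamma> l =
     - (b \<bullet> l) + \<gamma> * ln (\<Sum>j\<in>UNIV. exp ((column j A \<bullet> l - c $ j) / \<gamma>))"

end

theory Submission
  imports Defs
begin

text \<open>
  Write \<open>w\<^sub>j\<close> for the exponential with exponent \<open>(a\<^sub>j \<bullet> l - c\<^sub>j) / \<gamma>\<close>. Differentiating \<open>w\<^sub>j\<close> in direction \<open>u\<close>
  multiplies it by \<open>(a\<^sub>j \<bullet> u) / \<gamma>\<close>, so the sum-exp dual has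
  Hessian form \<open>(\<Sum>j. w\<^sub>j * (a\<^sub>j \<bullet> u)\<^sup>2) / \<gamma>\<close> and third derivative
  \<open>(\<Sum>j. w\<^sub>j * (a\<^sub>j \<bullet> u)\<^sup>2 * (a\<^sub>j \<bullet> v)) / \<gamma>\<^sup>2\<close> (\<open>nabla2_se\<close>, \<open>nabla3_se\<close>). The second is the first with one
  extra factor \<open>(a\<^sub>j \<bullet> v) / \<gamma>\<close> under a sum of nonnegative terms; bounding that factor by its
  maximum, and the maximum by Cauchy-Schwarz, gives both inequalities.

  For the log-sum-exp dual the weights are normalised to probabilities \<open>p\<^sub>j\<close>, and differentiating
  \<open>p\<^sub>j\<close> multiplies it by the deviation of \<open>a\<^sub>j \<bullet> u\<close> from its mean, over \<open>\<gamma>\<close>. Hence the Hessian is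
  a variance and the third derivative a third central moment (\<open>nabla2_lse\<close>, \<open>nabla3_lse\<close>).
  The argument is then the same, except that the extra factor is the deviation of \<open>a\<^sub>j \<bullet> v\<close> from
  its mean, which can be twice as large as the largest \<open>\<bar>a\<^sub>j \<bullet> v\<bar>\<close>: this is the factor 2.

  Both Hessians are nonnegative, which gives convexity. To obtain three continuous derivatives, each
  derivative is written as a finite sum of scalar functions times fixed bounded linear maps, a shape
  that differentiation preserves (\<open>has_derivative_sum_scaleR\<close>).
\<close>

section \<open>Iterated derivatives of finite sums\<close>

text \<open>
  The rank-one map \<open>\<phi> \<otimes> y\<close>. Composing bounded linear functions, instead of wrapping the function
  \<open>\<lambda>h. \<phi> h *\<^sub>R y\<close>, makes its continuity in \<open>\<phi>\<close> an instance of continuity of composition.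
\<close>

definition outer ::
    "('a::real_normed_vector \<Rightarrow>\<^sub>L real) \<Rightarrow> 'b::real_normed_vector \<Rightarrow> ('a \<Rightarrow>\<^sub>L 'b)" where
  "outer \<phi> y = blinfun_scaleR_left y o\<^sub>L \<phi>"

lemma outer_apply [simp]: "blinfun_apply (outer \<phi> y) h = blinfun_apply \<phi> h *\<^sub>R y"
  by (simp add: outer_def)

lemma continuous_on_outer [continuous_intros]:
  assumes "continuous_on S \<phi>"
  shows "continuous_on S (\<lambda>x. outer (\<phi> x) y)"
  unfolding outer_def using assms by (intro continuous_intros)

text \<open>
  Since the vectors \<open>y i\<close> are fixed, only the scalar coefficients have to be differentiated, even
  when the \<open>y i\<close> are themselves linear or multilinear forms. All higher derivatives below come from
  this rule.
\<close>

lemma has_derivative_sum_scaleR: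
  assumes "\<And>i. i \<in> I \<Longrightarrow> (g i has_derivative blinfun_apply (G i)) (at x)"
  shows "((\<lambda>x. \<Sum>i\<in>I. g i x *\<^sub>R y i) has_derivative
           blinfun_apply (\<Sum>i\<in>I. outer (G i) (y i))) (at x)"
  by (rule has_derivative_eq_rhs, (rule derivative_intros assms | assumption)+)
     (auto simp: blinfun.sum_left)

lemma fderiv_eqI:
  assumes "\<And>x. (f has_derivative blinfun_apply (D x)) (at x)"
  shows "fderiv f = D"
proof
  fix x
  show "fderiv f x = D x"
    using frechet_derivative_at[OF assms[of x]]
    by (metis fderiv_def blinfun_apply_inverse)
qed

lemma
  assumes D1: "\<And>x. (f has_derivative blinfun_apply (D1 x)) (at x)"
    and D2: "\<And>x. (D1 has_derivative blinfun_apply (D2 x)) (at x)"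
    and D3: "\<And>x. (D2 has_derivative blinfun_apply (D3 x)) (at x)"
  shows nabla2_eqI: "nabla2 f x u v = blinfun_apply (blinfun_apply (D2 x) u) v"
    and nabla3_eqI:
      "nabla3 f x u v w = blinfun_apply (blinfun_apply (blinfun_apply (D3 x) u) v) w"
    and C3I: "continuous_on UNIV D3 \<Longrightarrow> C3 f"
proof -
  note eqs = fderiv_eqI[of f D1, OF D1] fderiv_eqI[of D1 D2, OF D2] fderiv_eqI[of D2 D3, OF D3]
  show "nabla2 f x u v = blinfun_apply (blinfun_apply (D2 x) u) v"
    by (simp add: nabla2_def eqs)
  show "nabla3 f x u v w = blinfun_apply (blinfun_apply (blinfun_apply (D3 x) u) v) w"
    by (simp add: nabla3_def eqs)
  show "C3 f" if "continuous_on UNIV D3"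
    using that D1 D2 D3 unfolding C3_def eqs differentiable_def by blast
qed

section \<open>Convexity from the Hessian\<close>

lemma has_derivative_fderiv:
  assumes "f differentiable (at x)"
  shows "(f has_derivative blinfun_apply (fderiv f x)) (at x)"
proof -
  have "(f has_derivative frechet_derivative f (at x)) (at x)"
    using assms by (simp add: frechet_derivative_works)
  then show ?thesis
    by (simp add: fderiv_def bounded_linear_Blinfun_apply has_derivative_bounded_linear)
qed

text \<open>
  Along the segment from \<open>x\<close> to \<open>y\<close> the function becomes a real function whose second derivative is
  the Hessian form in direction \<open>y - x\<close>, so the one-dimensional criterion applies.
\<close>

lemma convex_on_nabla2_nonneg:
  fixes f :: "'a::real_normed_vector \<Rightarrow> real"
  assumes "\<And>x. f differentiable (at x)" and "\<And>x. fderiv f differentiable (at x)"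
    and "\<And>x u. 0 \<le> nabla2 f x u u"
  shows "convex_on UNIV f"
proof (rule convex_onI)
  fix t :: real and x y :: 'a
  assume t: "0 < t" "t < 1"
  define u where "u = y - x"
  define p where "p = (\<lambda>s. x + s *\<^sub>R u)"
  have p: "(p has_derivative (\<lambda>h. h *\<^sub>R u)) (at s)" for s
    unfolding p_def by (auto intro!: derivative_eq_intros)
  have d1: "((\<lambda>s. f (p s)) has_real_derivative fderiv f (p s) u) (at s)" for s
    using has_derivative_compose[OF p[of s] has_derivative_fderiv[OF assms(1)]]
    by (simp add: has_field_derivative_def blinfun.scaleR_right mult.commute[of _ "fderiv f (p s) u"])
  have d2: "((\<lambda>s. fderiv f (p s) u) has_real_derivative nabla2 f (p s) u u) (at s)" for s
  proof -
    have "((\<lambda>s. fderiv f (p s)) has_derivative (\<lambda>h. fderiv (fderiv f) (p s) (h *\<^sub>R u))) (at s)"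
      by (rule has_derivative_compose[OF p[of s] has_derivative_fderiv[OF assms(2)]])
    from bounded_linear.has_derivative[OF blinfun.bounded_linear_left this, of u]
    show ?thesis
      by (simp add: has_field_derivative_def nabla2_def blinfun.scaleR_right blinfun.scaleR_left
          mult.commute[of _ "fderiv (fderiv f) (p s) u u"])
  qed
  have "convex_on UNIV (\<lambda>s. f (p s))"
    by (rule f''_ge0_imp_convex[OF _ d1 d2]) (auto simp: assms(3))
  from convex_onD[OF this, of t 0 1] t
  have "f (p t) \<le> (1 - t) * f (p 0) + t * f (p 1)" by simp
  then show "f ((1 - t) *\<^sub>R x + t *\<^sub>R y) \<le> (1 - t) * f x + t * f y"
    by (simp add: p_def u_def algebra_simps)
qed simp

lemma quasi_self_concordantI:
  assumes "C3 f" and "\<And>x u. 0 \<le> nabla2 f x u u"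
    and "\<And>x u v. \<bar>nabla3 f x u u v\<bar> \<le> M * nabla2 f x u u * norm v"
  shows "quasi_self_concordant f M"
  using assms convex_on_nabla2_nonneg[of f]
  unfolding quasi_self_concordant_def C3_def by blast

section \<open>Weighted sums\<close>

lemma abs_weighted_sum_squares_le:
  fixes w d s :: "'i \<Rightarrow> real"
  assumes "\<And>i. i \<in> I \<Longrightarrow> 0 \<le> w i" and "\<And>i. i \<in> I \<Longrightarrow> \<bar>s i\<bar> \<le> B"
  shows "\<bar>\<Sum>i\<in>I. w i * (d i)\<^sup>2 * s i\<bar> \<le> B * (\<Sum>i\<in>I. w i * (d i)\<^sup>2)"
proof -
  have "\<bar>\<Sum>i\<in>I. w i * (d i)\<^sup>2 * s i\<bar> \<le> (\<Sum>i\<in>I. \<bar>w i * (d i)\<^sup>2 * s i\<bar>)"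
    by (rule sum_abs)
  also have "\<dots> \<le> (\<Sum>i\<in>I. B * (w i * (d i)\<^sup>2))"
  proof (rule sum_mono)
    fix i assume i: "i \<in> I"
    have "\<bar>w i * (d i)\<^sup>2 * s i\<bar> = (w i * (d i)\<^sup>2) * \<bar>s i\<bar>"
      using assms(1)[OF i] by (simp add: abs_mult)
    also have "\<dots> \<le> (w i * (d i)\<^sup>2) * B"
      by (rule mult_left_mono) (use assms i in auto)
    finally show "\<bar>w i * (d i)\<^sup>2 * s i\<bar> \<le> B * (w i * (d i)\<^sup>2)" by (simp add: mult.commute)
  qed
  finally show ?thesis by (simp add: sum_distrib_left)
qed

lemma
  fixes p U W :: "'i \<Rightarrow> real"
  assumes "(\<Sum>i\<in>I. p i) = 1"
  defines "m \<equiv> \<Sum>i\<in>I. p i * U i" and "n \<equiv> \<Sum>i\<in>I. p i * W i"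
  shows second_central_moment:
      "(\<Sum>i\<in>I. p i * (U i - m)\<^sup>2) = (\<Sum>i\<in>I. p i * (U i)\<^sup>2) - m\<^sup>2"
    and third_central_moment:
      "(\<Sum>i\<in>I. p i * (U i - m)\<^sup>2 * (W i - n)) =
         (\<Sum>i\<in>I. p i * (U i)\<^sup>2 * W i) - n * (\<Sum>i\<in>I. p i * (U i)\<^sup>2)
           - 2 * m * (\<Sum>i\<in>I. p i * U i * W i) + 2 * m\<^sup>2 * n"
proof -
  have "(\<Sum>i\<in>I. p i * (U i - m)\<^sup>2) =
      (\<Sum>i\<in>I. p i * (U i)\<^sup>2 - 2 * m * (p i * U i) + m\<^sup>2 * p i)"
    by (rule sum.cong) (auto simp: power2_eq_square algebra_simps)
  also have "\<dots> = (\<Sum>i\<in>I. p i * (U i)\<^sup>2) - 2 * m * (\<Sum>i\<in>I. p i * U i) + m\<^sup>2 * (\<Sum>i\<in>I. p i)"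
    by (simp add: sum.distrib sum_subtractf sum_distrib_left)
  finally show "(\<Sum>i\<in>I. p i * (U i - m)\<^sup>2) = (\<Sum>i\<in>I. p i * (U i)\<^sup>2) - m\<^sup>2"
    by (simp add: assms(1) m_def[symmetric] power2_eq_square)
  have "(\<Sum>i\<in>I. p i * (U i - m)\<^sup>2 * (W i - n)) =
      (\<Sum>i\<in>I. p i * (U i)\<^sup>2 * W i - n * (p i * (U i)\<^sup>2) - 2 * m * (p i * U i * W i)
         + 2 * m * n * (p i * U i) + m\<^sup>2 * (p i * W i) - m\<^sup>2 * n * p i)"
    by (rule sum.cong) (auto simp: power2_eq_square algebra_simps)
  also have "\<dots> = (\<Sum>i\<in>I. p i * (U i)\<^sup>2 * W i) - n * (\<Sum>i\<in>I. p i * (U i)\<^sup>2)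
      - 2 * m * (\<Sum>i\<in>I. p i * U i * W i) + 2 * m * n * (\<Sum>i\<in>I. p i * U i)
      + m\<^sup>2 * (\<Sum>i\<in>I. p i * W i) - m\<^sup>2 * n * (\<Sum>i\<in>I. p i)"
    by (simp only: sum.distrib sum_subtractf sum_distrib_left)
  finally show "(\<Sum>i\<in>I. p i * (U i - m)\<^sup>2 * (W i - n)) =
         (\<Sum>i\<in>I. p i * (U i)\<^sup>2 * W i) - n * (\<Sum>i\<in>I. p i * (U i)\<^sup>2)
           - 2 * m * (\<Sum>i\<in>I. p i * U i * W i) + 2 * m\<^sup>2 * n"
    by (simp add: assms(1) m_def[symmetric] n_def[symmetric] power2_eq_square)
qed

text \<open>
  A weighted mean of numbers in \<open>[-B, B]\<close> lies in that interval, whose length is \<open>2 * B\<close>.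
\<close>

lemma abs_diff_weighted_mean_le:
  fixes p W :: "'i \<Rightarrow> real"
  assumes "(\<Sum>i\<in>I. p i) = 1" and "\<And>i. i \<in> I \<Longrightarrow> 0 \<le> p i"
    and "\<And>i. i \<in> I \<Longrightarrow> \<bar>W i\<bar> \<le> B" and "j \<in> I"
  shows "\<bar>W j - (\<Sum>i\<in>I. p i * W i)\<bar> \<le> 2 * B"
proof -
  have "\<bar>\<Sum>i\<in>I. p i * W i\<bar> \<le> (\<Sum>i\<in>I. \<bar>p i * W i\<bar>)" by (rule sum_abs)
  also have "\<dots> \<le> (\<Sum>i\<in>I. p i * B)"
    by (rule sum_mono) (use assms in \<open>auto simp: abs_mult intro!: mult_left_mono\<close>)
  also have "\<dots> = B" by (simp add: assms(1) flip: sum_distrib_right)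
  finally show ?thesis using assms(3)[OF assms(4)] by linarith
qed

section \<open>The two exponential duals\<close>

text \<open>
  Both duals depend on the matrix only through the inner products of its columns, here the vectors
  \<open>a j\<close>, with the dual variable.
\<close>

locale exponential_duals =
  fixes a :: "'i::finite \<Rightarrow> 'a::euclidean_space" and b :: 'a and c :: "'i \<Rightarrow> real" and \<gamma> :: real
  assumes \<gamma>_pos: "0 < \<gamma>"
begin

definition weight :: "'i \<Rightarrow> 'a \<Rightarrow> real" where
  "weight j l = exp ((a j \<bullet> l - c j) / \<gamma>)"

abbreviation L :: "'i \<Rightarrow> 'a \<Rightarrow>\<^sub>L real" where
  "L j \<equiv> blinfun_inner_right (a j)"

definition se :: "'a \<Rightarrow> real" where
  "se l = - (b \<bullet> l) + \<gamma> * (\<Sum>j\<in>UNIV. weight j l)"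

definition lse :: "'a \<Rightarrow> real" where
  "lse l = - (b \<bullet> l) + \<gamma> * ln (\<Sum>j\<in>UNIV. weight j l)"

lemma weight_pos [simp]: "0 < weight j l"
  by (simp add: weight_def)

lemma weight_nonneg [simp]: "0 \<le> weight j l"
  by (simp add: weight_def)

lemma has_derivative_weight:
  "(weight j has_derivative blinfun_apply ((weight j l / \<gamma>) *\<^sub>R L j)) (at l)"
  unfolding weight_def using \<gamma>_pos
  by (auto intro!: derivative_eq_intros simp: blinfun.scaleR_left)

lemma continuous_on_weight [continuous_intros]: "continuous_on S (weight j)"
  unfolding weight_def using \<gamma>_pos by (intro continuous_intros) auto

subsection \<open>Sum-exp\<close>

lemma has_derivative_se:
  "(se has_derivative
     blinfun_apply ((\<Sum>j\<in>UNIV. weight j l *\<^sub>R L j) - blinfun_inner_right b)) (at l)"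
  unfolding se_def using \<gamma>_pos
  by (auto intro!: derivative_eq_intros has_derivative_weight
      simp: blinfun.scaleR_left blinfun.sum_left blinfun.diff_left sum_distrib_left)

lemma has_derivative_gradient_se:
  "((\<lambda>l. (\<Sum>j\<in>UNIV. weight j l *\<^sub>R L j) - blinfun_inner_right b) has_derivative
     blinfun_apply (\<Sum>j\<in>UNIV. (weight j l / \<gamma>) *\<^sub>R outer (L j) (L j))) (at l)"
proof -
  have "((\<lambda>l. (\<Sum>j\<in>UNIV. weight j l *\<^sub>R L j) - blinfun_inner_right b) has_derivative
     (\<lambda>h. blinfun_apply (\<Sum>j\<in>UNIV. outer ((weight j l / \<gamma>) *\<^sub>R L j) (L j)) h - 0)) (at l)"
    by (intro has_derivative_diff has_derivative_sum_scaleR has_derivative_weight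
        has_derivative_const)
  then show ?thesis
    by (rule has_derivative_eq_rhs) (auto simp: blinfun.sum_left blinfun.scaleR_left)
qed

lemma has_derivative_Hessian_se:
  "((\<lambda>l. \<Sum>j\<in>UNIV. (weight j l / \<gamma>) *\<^sub>R outer (L j) (L j)) has_derivative
     blinfun_apply
       (\<Sum>j\<in>UNIV. outer ((weight j l / \<gamma>\<^sup>2) *\<^sub>R L j) (outer (L j) (L j)))) (at l)"
proof (rule has_derivative_sum_scaleR)
  fix j
  have "((\<lambda>l. weight j l / \<gamma>) has_derivative
      (\<lambda>h. blinfun_apply ((weight j l / \<gamma>) *\<^sub>R L j) h / \<gamma>)) (at l)"
    by (rule bounded_linear.has_derivative[OF bounded_linear_divide has_derivative_weight])
  then show "((\<lambda>l. weight j l / \<gamma>) has_derivative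
      blinfun_apply ((weight j l / \<gamma>\<^sup>2) *\<^sub>R L j)) (at l)"
    by (rule has_derivative_eq_rhs) (auto simp: blinfun.scaleR_left power2_eq_square)
qed

lemmas se_derivatives = has_derivative_se has_derivative_gradient_se has_derivative_Hessian_se

lemma C3_se: "C3 se"
  by (rule C3I[OF se_derivatives]) (use \<gamma>_pos in \<open>intro continuous_intros, auto\<close>)

lemma nabla2_se: "nabla2 se l u u = (\<Sum>j\<in>UNIV. weight j l * (a j \<bullet> u)\<^sup>2) / \<gamma>"
  by (simp add: nabla2_eqI[OF se_derivatives] blinfun.sum_left blinfun.scaleR_left
      power2_eq_square sum_divide_distrib mult.assoc)

lemma nabla3_se:
  "nabla3 se l u u v = (\<Sum>j\<in>UNIV. weight j l * (a j \<bullet> u)\<^sup>2 * (a j \<bullet> v)) / \<gamma>\<^sup>2"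
  by (simp add: nabla3_eqI[OF se_derivatives] blinfun.sum_left blinfun.scaleR_left
      power2_eq_square sum_divide_distrib mult.assoc)

lemma nabla2_se_nonneg: "0 \<le> nabla2 se l u u"
  using \<gamma>_pos by (simp add: nabla2_se sum_nonneg)

text \<open>
  The bound \<open>B\<close> is left free, since it serves both for the maximum of \<open>\<bar>a j \<bullet> v\<bar>\<close> and for its
  Cauchy-Schwarz estimate.
\<close>

lemma abs_nabla3_se_le:
  assumes "\<And>j. \<bar>a j \<bullet> v\<bar> \<le> B"
  shows "\<bar>nabla3 se l u u v\<bar> \<le> B / \<gamma> * nabla2 se l u u"
proof -
  have "\<bar>nabla3 se l u u v\<bar> = \<bar>\<Sum>j\<in>UNIV. weight j l * (a j \<bullet> u)\<^sup>2 * (a j \<bullet> v)\<bar> / \<gamma>\<^sup>2"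
    by (simp add: nabla3_se)
  also have "\<dots> \<le> (B * (\<Sum>j\<in>UNIV. weight j l * (a j \<bullet> u)\<^sup>2)) / \<gamma>\<^sup>2"
    by (intro divide_right_mono abs_weighted_sum_squares_le) (auto simp: assms)
  also have "\<dots> = B / \<gamma> * nabla2 se l u u"
    by (simp add: nabla2_se power2_eq_square)
  finally show ?thesis .
qed

subsection \<open>Log-sum-exp\<close>

text \<open>
  The Gibbs distribution of the exponents, that is, their softmax. The gradient of the log-sum-exp
  term is the mean of the forms \<open>L j\<close> under it.
\<close>

definition prob :: "'i \<Rightarrow> 'a \<Rightarrow> real" where
  "prob j l = weight j l / (\<Sum>k\<in>UNIV. weight k l)"

definition mean :: "'a \<Rightarrow> 'a \<Rightarrow>\<^sub>L real" where
  "mean l = (\<Sum>k\<in>UNIV. prob k l *\<^sub>R L k)"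

lemma sum_weight_pos: "0 < (\<Sum>k\<in>UNIV. weight k l)"
  by (simp add: sum_pos)

lemma sum_weight_neq_0 [simp]: "(\<Sum>k\<in>UNIV. weight k l) \<noteq> 0"
  using sum_weight_pos[of l] by simp

lemma prob_nonneg: "0 \<le> prob j l"
  using sum_weight_pos[of l] by (simp add: prob_def)

lemma sum_prob: "(\<Sum>j\<in>UNIV. prob j l) = 1"
  by (simp add: prob_def flip: sum_divide_distrib)

lemma mean_apply: "blinfun_apply (mean l) h = (\<Sum>j\<in>UNIV. prob j l * (a j \<bullet> h))"
  by (simp add: mean_def blinfun.sum_left blinfun.scaleR_left)

lemma continuous_on_prob [continuous_intros]: "continuous_on S (prob j)"
  unfolding prob_def by (intro continuous_intros) auto

lemma continuous_on_mean [continuous_intros]: "continuous_on S mean"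
  unfolding mean_def by (intro continuous_intros)

text \<open>
  The quotient rule subtracts the logarithmic derivative of the normalising sum, which is the mean
  divided by \<open>\<gamma>\<close>; this is what centres all the moments below.
\<close>

lemma has_derivative_prob:
  "(prob j has_derivative blinfun_apply ((prob j l / \<gamma>) *\<^sub>R (L j - mean l))) (at l)"
proof -
  let ?S = "\<Sum>k\<in>UNIV. weight k l"
  have "(prob j has_derivative (\<lambda>h. (weight j l / \<gamma> * (a j \<bullet> h) * ?S
      - weight j l * (\<Sum>k\<in>UNIV. weight k l / \<gamma> * (a k \<bullet> h))) / (?S * ?S))) (at l)"
    unfolding prob_def
    by (rule has_derivative_eq_rhs,
        rule has_derivative_divide'[OF has_derivative_weight
          has_derivative_sum[OF has_derivative_weight]])
       (auto simp: blinfun.scaleR_left)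
  moreover have "(weight j l / \<gamma> * (a j \<bullet> h) * ?S
      - weight j l * (\<Sum>k\<in>UNIV. weight k l / \<gamma> * (a k \<bullet> h))) / (?S * ?S)
    = blinfun_apply ((prob j l / \<gamma>) *\<^sub>R (L j - mean l)) h" for h
  proof -
    have "blinfun_apply (mean l) h = (\<Sum>k\<in>UNIV. weight k l * (a k \<bullet> h)) / ?S"
      by (simp add: mean_apply prob_def sum_divide_distrib)
    moreover have "(\<Sum>k\<in>UNIV. weight k l / \<gamma> * (a k \<bullet> h))
        = (\<Sum>k\<in>UNIV. weight k l * (a k \<bullet> h)) / \<gamma>"
      by (simp add: sum_divide_distrib)
    ultimately show ?thesis
      using \<gamma>_pos sum_weight_neq_0[of l]
      by (simp add: blinfun.scaleR_left blinfun.diff_left prob_def field_simps)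
  qed
  ultimately show ?thesis by simp
qed

lemma has_derivative_lse:
  "(lse has_derivative
     blinfun_apply ((\<Sum>j\<in>UNIV. prob j l *\<^sub>R L j) - blinfun_inner_right b)) (at l)"
proof -
  have deriv: "(lse has_derivative (\<lambda>h. - (b \<bullet> h) + \<gamma> * ((\<Sum>k\<in>UNIV. weight k l / \<gamma> * (a k \<bullet> h)) /
      (\<Sum>k\<in>UNIV. weight k l)))) (at l)"
    unfolding lse_def
    by (auto intro!: derivative_eq_intros has_derivative_weight
        simp: sum_weight_pos blinfun.scaleR_left divide_inverse mult.commute)
  have mean: "\<gamma> * ((\<Sum>k\<in>UNIV. weight k l / \<gamma> * (a k \<bullet> h)) / (\<Sum>k\<in>UNIV. weight k l))
      = (\<Sum>k\<in>UNIV. prob k l * (a k \<bullet> h))" for h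
  proof -
    have "(\<Sum>k\<in>UNIV. weight k l / \<gamma> * (a k \<bullet> h)) = (\<Sum>k\<in>UNIV. weight k l * (a k \<bullet> h)) / \<gamma>"
      by (simp add: sum_divide_distrib)
    then show ?thesis
      using \<gamma>_pos by (simp add: prob_def flip: sum_divide_distrib)
  qed
  show ?thesis
    using deriv unfolding mean
    by (rule has_derivative_eq_rhs)
       (auto simp: blinfun.diff_left blinfun.sum_left blinfun.scaleR_left)
qed

text \<open>
  The covariance of the forms \<open>L j\<close>, divided by \<open>\<gamma>\<close>. The product of means is expanded into a sum over
  pairs, so that all coefficients are scalar and the rule for sums applies again.
\<close>

definition Hessian_lse :: "'a \<Rightarrow> 'a \<Rightarrow>\<^sub>L 'a \<Rightarrow>\<^sub>L real" where
  "Hessian_lse l =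
     (\<Sum>j\<in>UNIV. (prob j l / \<gamma>) *\<^sub>R outer (L j) (L j))
       - (\<Sum>(j, k)\<in>UNIV. (prob j l * prob k l / \<gamma>) *\<^sub>R outer (L j) (L k))"

text \<open>
  The coefficient \<open>prob j l * prob k l\<close> of a pair has logarithmic derivative
  \<open>(L j + L k - 2 *\<^sub>R mean l) / \<gamma>\<close>, by the product rule.
\<close>

definition third_derivative_lse :: "'a \<Rightarrow> 'a \<Rightarrow>\<^sub>L 'a \<Rightarrow>\<^sub>L 'a \<Rightarrow>\<^sub>L real" where
  "third_derivative_lse l =
     (\<Sum>j\<in>UNIV. outer ((prob j l / \<gamma>\<^sup>2) *\<^sub>R (L j - mean l)) (outer (L j) (L j)))
       - (\<Sum>(j, k)\<in>UNIV.
            outer ((prob j l * prob k l / \<gamma>\<^sup>2) *\<^sub>R (L j + L k - 2 *\<^sub>R mean l)) (outer (L j) (L k)))"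

lemma has_derivative_gradient_lse:
  "((\<lambda>l. (\<Sum>j\<in>UNIV. prob j l *\<^sub>R L j) - blinfun_inner_right b) has_derivative
     blinfun_apply (Hessian_lse l)) (at l)"
proof -
  have "((\<lambda>l. (\<Sum>j\<in>UNIV. prob j l *\<^sub>R L j) - blinfun_inner_right b) has_derivative
     (\<lambda>h. blinfun_apply (\<Sum>j\<in>UNIV. outer ((prob j l / \<gamma>) *\<^sub>R (L j - mean l)) (L j)) h - 0)) (at l)"
    by (intro has_derivative_diff has_derivative_sum_scaleR has_derivative_prob
        has_derivative_const)
  moreover have "(\<Sum>j\<in>UNIV. outer ((prob j l / \<gamma>) *\<^sub>R (L j - mean l)) (L j)) = Hessian_lse l"
  proof (intro blinfun_eqI)
    fix h v
    let ?p = "\<lambda>j. prob j l"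
    have "blinfun_apply (blinfun_apply
        (\<Sum>j\<in>UNIV. outer ((?p j / \<gamma>) *\<^sub>R (L j - mean l)) (L j)) h) v
      = (\<Sum>j\<in>UNIV. ?p j / \<gamma> * (a j \<bullet> h) * (a j \<bullet> v))
        - blinfun_apply (mean l) h * (\<Sum>j\<in>UNIV. ?p j / \<gamma> * (a j \<bullet> v))"
      by (simp add: blinfun.sum_left blinfun.scaleR_left blinfun.diff_left algebra_simps
          sum_subtractf sum_distrib_left diff_divide_distrib)
    also have "blinfun_apply (mean l) h * (\<Sum>j\<in>UNIV. ?p j / \<gamma> * (a j \<bullet> v))
      = (\<Sum>(j, k)\<in>UNIV. (?p j * ?p k / \<gamma>) * ((a j \<bullet> h) * (a k \<bullet> v)))"
      unfolding mean_apply sum_product sum.cartesian_product UNIV_Times_UNIV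
      by (rule sum.cong) auto
    finally show "blinfun_apply (blinfun_apply
        (\<Sum>j\<in>UNIV. outer ((?p j / \<gamma>) *\<^sub>R (L j - mean l)) (L j)) h) v
      = blinfun_apply (blinfun_apply (Hessian_lse l) h) v"
      by (simp add: Hessian_lse_def blinfun.sum_left blinfun.scaleR_left blinfun.diff_left
          case_prod_unfold mult.assoc)
  qed
  ultimately show ?thesis by simp
qed

lemma has_derivative_Hessian_lse:
  "(Hessian_lse has_derivative blinfun_apply (third_derivative_lse l)) (at l)"
proof -
  have p: "((\<lambda>l. prob j l / \<gamma>) has_derivative
      blinfun_apply ((prob j l / \<gamma>\<^sup>2) *\<^sub>R (L j - mean l))) (at l)" for j
    by (rule has_derivative_eq_rhs,
        rule bounded_linear.has_derivative[OF bounded_linear_divide has_derivative_prob])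
       (auto simp: blinfun.scaleR_left power2_eq_square)
  have pp: "((\<lambda>l. prob j l * prob k l / \<gamma>) has_derivative
      blinfun_apply ((prob j l * prob k l / \<gamma>\<^sup>2) *\<^sub>R (L j + L k - 2 *\<^sub>R mean l))) (at l)" for j k
  proof -
    have "((\<lambda>l. prob j l * prob k l / \<gamma>) has_derivative
      (\<lambda>h. (prob j l * blinfun_apply ((prob k l / \<gamma>) *\<^sub>R (L k - mean l)) h
        + blinfun_apply ((prob j l / \<gamma>) *\<^sub>R (L j - mean l)) h * prob k l) / \<gamma>)) (at l)"
      by (rule bounded_linear.has_derivative[OF bounded_linear_divide
            has_derivative_mult[OF has_derivative_prob has_derivative_prob]])
    moreover have "(prob j l * blinfun_apply ((prob k l / \<gamma>) *\<^sub>R (L k - mean l)) h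
        + blinfun_apply ((prob j l / \<gamma>) *\<^sub>R (L j - mean l)) h * prob k l) / \<gamma>
      = blinfun_apply ((prob j l * prob k l / \<gamma>\<^sup>2) *\<^sub>R (L j + L k - 2 *\<^sub>R mean l)) h" for h
      using \<gamma>_pos by (simp add: blinfun.scaleR_left blinfun.diff_left blinfun.add_left
          power2_eq_square field_simps)
    ultimately show ?thesis by simp
  qed
  show ?thesis
    unfolding Hessian_lse_def third_derivative_lse_def blinfun.diff_left case_prod_unfold
    by (intro has_derivative_diff has_derivative_sum_scaleR p pp)
qed

lemmas lse_derivatives = has_derivative_lse has_derivative_gradient_lse has_derivative_Hessian_lse

lemma C3_lse: "C3 lse"
  by (rule C3I[OF lse_derivatives])
     (unfold third_derivative_lse_def case_prod_unfold,
      use \<gamma>_pos in \<open>intro continuous_intros, auto\<close>)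

lemma nabla2_lse:
  "nabla2 lse l u u = (\<Sum>j\<in>UNIV. prob j l * (a j \<bullet> u - mean l u)\<^sup>2) / \<gamma>"
proof -
  let ?p = "\<lambda>j. prob j l" and ?U = "\<lambda>j. a j \<bullet> u"
  have "nabla2 lse l u u = ((\<Sum>j\<in>UNIV. ?p j * (?U j)\<^sup>2)
      - (\<Sum>(j, k)\<in>UNIV. (?p j * ?U j) * (?p k * ?U k))) / \<gamma>"
    by (simp add: nabla2_eqI[OF lse_derivatives] Hessian_lse_def blinfun.sum_left
        blinfun.diff_left blinfun.scaleR_left case_prod_unfold power2_eq_square
        sum_divide_distrib diff_divide_distrib mult_ac)
  also have "(\<Sum>(j, k)\<in>UNIV. (?p j * ?U j) * (?p k * ?U k)) = (mean l u)\<^sup>2"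
    by (simp add: mean_apply power2_eq_square sum_product sum.cartesian_product)
  finally show ?thesis
    by (simp add: mean_apply second_central_moment[OF sum_prob])
qed

text \<open>
  Evaluating the third derivative gives raw moments: the mean of \<open>U\<^sup>2 V\<close>, minus twice the mean of
  \<open>U\<close> times that of \<open>U V\<close>, minus the mean of \<open>U\<^sup>2\<close> times that of \<open>V\<close>, plus twice the squared mean of
  \<open>U\<close> times the mean of \<open>V\<close>. This is the expansion of the mixed third central moment.
\<close>

lemma nabla3_lse:
  "nabla3 lse l u u v =
     (\<Sum>j\<in>UNIV. prob j l * (a j \<bullet> u - mean l u)\<^sup>2 * (a j \<bullet> v - mean l v)) / \<gamma>\<^sup>2"
proof -
  let ?p = "\<lambda>j. prob j l" and ?U = "\<lambda>j. a j \<bullet> u" and ?V = "\<lambda>j. a j \<bullet> v"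
  let ?m = "mean l u" and ?n = "mean l v"
  have "nabla3 lse l u u v = ((\<Sum>j\<in>UNIV. ?p j * (?U j - ?m) * ?U j * ?V j)
      - (\<Sum>(j, k)\<in>UNIV. ?p j * ?p k * (?U j + ?U k - 2 * ?m) * ?U j * ?V k)) / \<gamma>\<^sup>2"
    by (simp add: nabla3_eqI[OF lse_derivatives] third_derivative_lse_def blinfun.sum_left
        blinfun.diff_left blinfun.add_left blinfun.scaleR_left case_prod_unfold
        sum_divide_distrib diff_divide_distrib mult.assoc)
  also have "(\<Sum>j\<in>UNIV. ?p j * (?U j - ?m) * ?U j * ?V j)
      = (\<Sum>j\<in>UNIV. ?p j * (?U j)\<^sup>2 * ?V j) - ?m * (\<Sum>j\<in>UNIV. ?p j * ?U j * ?V j)"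
    unfolding sum_distrib_left sum_subtractf[symmetric]
    by (rule sum.cong) (auto simp: power2_eq_square algebra_simps)
  also have "(\<Sum>(j, k)\<in>UNIV. ?p j * ?p k * (?U j + ?U k - 2 * ?m) * ?U j * ?V k)
      = (\<Sum>j\<in>UNIV. ?p j * (?U j)\<^sup>2) * (\<Sum>k\<in>UNIV. ?p k * ?V k)
        + (\<Sum>j\<in>UNIV. ?p j * ?U j) * (\<Sum>k\<in>UNIV. ?p k * ?U k * ?V k)
        - 2 * ?m * ((\<Sum>j\<in>UNIV. ?p j * ?U j) * (\<Sum>k\<in>UNIV. ?p k * ?V k))"
  proof -
    \<comment> \<open>With every product of sums turned into a sum over pairs, both sides agree termwise.\<close>
    have prod: "(\<Sum>j\<in>UNIV. x j) * (\<Sum>k\<in>UNIV. y k) = (\<Sum>i\<in>UNIV. x (fst i) * y (snd i))"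
      for x y :: "'i \<Rightarrow> real"
      by (simp add: sum_product sum.cartesian_product case_prod_unfold)
    show ?thesis
      unfolding prod
      unfolding sum_distrib_left sum.distrib[symmetric] sum_subtractf[symmetric]
      by (rule sum.cong) (auto simp: power2_eq_square algebra_simps)
  qed
  also have "(\<Sum>j\<in>UNIV. ?p j * ?U j) = ?m" by (simp add: mean_apply)
  also have "(\<Sum>k\<in>UNIV. ?p k * ?V k) = ?n" by (simp add: mean_apply)
  also have "(\<Sum>j\<in>UNIV. ?p j * (?U j)\<^sup>2 * ?V j) - ?m * (\<Sum>j\<in>UNIV. ?p j * ?U j * ?V j)
        - ((\<Sum>j\<in>UNIV. ?p j * (?U j)\<^sup>2) * ?n + ?m * (\<Sum>j\<in>UNIV. ?p j * ?U j * ?V j)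
           - 2 * ?m * (?m * ?n))
      = (\<Sum>j\<in>UNIV. ?p j * (?U j - ?m)\<^sup>2 * (?V j - ?n))"
    unfolding third_central_moment[OF sum_prob, of l ?U ?V, folded mean_apply]
    by (simp add: power2_eq_square algebra_simps)
  finally show ?thesis .
qed

lemma nabla2_lse_nonneg: "0 \<le> nabla2 lse l u u"
  using \<gamma>_pos by (simp add: nabla2_lse sum_nonneg prob_nonneg)

text \<open>
  Compared with the sum-exp bound, the factor 2 pays for replacing \<open>a j \<bullet> v\<close> by its deviation from
  the mean.
\<close>

lemma abs_nabla3_lse_le:
  assumes "\<And>j. \<bar>a j \<bullet> v\<bar> \<le> B"
  shows "\<bar>nabla3 lse l u u v\<bar> \<le> 2 * B / \<gamma> * nabla2 lse l u u"
proof -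
  have "\<bar>a j \<bullet> v - mean l v\<bar> \<le> 2 * B" for j
    unfolding mean_apply
    by (rule abs_diff_weighted_mean_le) (auto simp: sum_prob prob_nonneg assms)
  then have "\<bar>nabla3 lse l u u v\<bar>
      \<le> (2 * B * (\<Sum>j\<in>UNIV. prob j l * (a j \<bullet> u - mean l u)\<^sup>2)) / \<gamma>\<^sup>2"
    unfolding nabla3_lse abs_divide abs_power2
    by (intro divide_right_mono abs_weighted_sum_squares_le) (auto simp: prob_nonneg)
  also have "\<dots> = 2 * B / \<gamma> * nabla2 lse l u u"
    by (simp add: nabla2_lse power2_eq_square)
  finally show ?thesis .
qed

end

section \<open>The bounds in terms of the columns\<close>

lemma norm_column_le_max_col_norm: "norm (column j A) \<le> max_col_norm A"
  unfolding max_col_norm_def by (rule Max_ge) auto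

lemma abs_column_inner_le: "\<bar>column j A \<bullet> v\<bar> \<le> max_col_norm A * norm v"
  by (rule order_trans[OF Cauchy_Schwarz_ineq2])
     (intro mult_right_mono norm_column_le_max_col_norm norm_ge_zero)

theorem proposition5p2:
  fixes A :: "real^'n^'m" and b q :: "real^'m" and c xbar :: "real^'n" and \<gamma> :: real
  assumes "\<gamma> > 0"
    and "transpose A *v q = 1" and "q \<bullet> b = 1"
    and "\<And>j. xbar $ j > 0" and "A *v xbar = b"
  shows "(\<forall>l u v.
            \<bar>nabla3 (sum_exp_dual A b c \<gamma>) l u u v\<bar>
              \<le> Max (range (\<lambda>j. \<bar>column j A \<bullet> v\<bar>)) / \<gamma> * nabla2 (sum_exp_dual A b c \<gamma>) l u u \<and>
            Max (range (\<lambda>j. \<bar>column j A \<bullet> v\<bar>)) / \<gamma> * nabla2 (sum_exp_dual A b c \<gamma>) l u u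
              \<le> max_col_norm A * norm v / \<gamma> * nabla2 (sum_exp_dual A b c \<gamma>) l u u) \<and>
         quasi_self_concordant (sum_exp_dual A b c \<gamma>) (max_col_norm A / \<gamma>) \<and>
         M_qsc (sum_exp_dual A b c \<gamma>) \<le> max_col_norm A / \<gamma> \<and>
         quasi_self_concordant (log_sum_exp_dual A b c \<gamma>) (2 * max_col_norm A / \<gamma>) \<and>
         max_col_norm A / \<gamma> \<le> 2 * max_col_norm A / \<gamma>"
proof -
  let ?f = "sum_exp_dual A b c \<gamma>" and ?g = "log_sum_exp_dual A b c \<gamma>" and ?\<rho> = "max_col_norm A"
  interpret exponential_duals "\<lambda>j. column j A" b "\<lambda>j. c $ j" \<gamma>
    by unfold_locales (rule assms(1))
  have f: "?f = se" by (auto simp: sum_exp_dual_def se_def weight_def)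
  have g: "?g = lse" by (auto simp: log_sum_exp_dual_def lse_def weight_def)
  have \<rho>: "0 \<le> ?\<rho>"
    using norm_column_le_max_col_norm norm_ge_zero by (rule order_trans[rotated])
  let ?mx = "\<lambda>v. Max (range (\<lambda>j. \<bar>column j A \<bullet> v\<bar>))"
  have bound1: "\<bar>nabla3 ?f l u u v\<bar> \<le> ?mx v / \<gamma> * nabla2 ?f l u u" for l u v
    unfolding f by (rule abs_nabla3_se_le) (auto intro!: Max_ge)
  have "?mx v \<le> ?\<rho> * norm v" for v
    by (subst Max_le_iff) (auto simp: abs_column_inner_le)
  then have bound2: "?mx v / \<gamma> * nabla2 ?f l u u \<le> ?\<rho> * norm v / \<gamma> * nabla2 ?f l u u" for l u v
    unfolding f using \<gamma>_pos
    by (intro mult_right_mono divide_right_mono nabla2_se_nonneg) auto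
  have qf: "quasi_self_concordant ?f (?\<rho> / \<gamma>)"
    unfolding f
  proof (rule quasi_self_concordantI[OF C3_se nabla2_se_nonneg])
    show "\<bar>nabla3 se l u u v\<bar> \<le> ?\<rho> / \<gamma> * nabla2 se l u u * norm v" for l u v
      using abs_nabla3_se_le[OF abs_column_inner_le, of l u v] by (simp add: mult_ac)
  qed
  have qg: "quasi_self_concordant ?g (2 * ?\<rho> / \<gamma>)"
    unfolding g
  proof (rule quasi_self_concordantI[OF C3_lse nabla2_lse_nonneg])
    show "\<bar>nabla3 lse l u u v\<bar> \<le> 2 * ?\<rho> / \<gamma> * nabla2 lse l u u * norm v" for l u v
      using abs_nabla3_lse_le[OF abs_column_inner_le, of l u v] by (simp add: mult_ac)
  qed
  have "M_qsc ?f \<le> ?\<rho> / \<gamma>"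
    unfolding M_qsc_def
    by (rule cInf_lower) (use qf \<rho> \<gamma>_pos in \<open>auto intro: bdd_belowI[of _ 0]\<close>)
  moreover have "?\<rho> / \<gamma> \<le> 2 * ?\<rho> / \<gamma>"
    using \<rho> \<gamma>_pos by (intro divide_right_mono) auto
  ultimately show ?thesis
    using bound1 bound2 qf qg by blast
qed

end
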